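(* Let $\lambda_\alpha,\lambda_\beta>0$, let $k\ge1$ be an integer, let $\tau_k^1$ be the first time at which a homogeneous Poisson process of rate $\lambda_\beta$ reaches level $k$, and let $N_\alpha$ be a homogeneous Poisson process of rate $\lambda_\alpha$ independent of $\tau_k^1$. Then $$N_\alpha(\tau_k^1)\overset{d}{=}X_1+\dots+X_N,$$ where $N$ is a Poisson random variable of parameter $$\mu=\log\left(\frac{\lambda_\alpha+\lambda_\beta}{\lambda_\beta}\right)^k,$$ and $X_1,X_2,\dots$ are i.i.d. random variables, independent of $N$, with logarithmic distribution of parameter $q=\lambda_\alpha/(\lambda_\alpha+\lambda_\beta)$.
   Context: The logarithmic distribution of parameter $q\in(0,1)$ is $\Pr\{X=r\}=-\frac{1}{\log(1-q)}\frac{q^r}{r}$, $r=1,2,\dots$. In the formula for $\mu$, the logarithm is taken of the $k$th power, i.e. $\mu=k\log\frac{\lambda_\alpha+\lambda_\beta}{\lambda_\beta}$. An empty sum equals $0$. *)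

theory Defs
  imports "HOL-Probability.Probability"
begin

context
  fixes q :: real
  assumes q_pos: "0 < q" and q_less_1: "q < 1"
begin

lift_definition logarithmic_pmf :: "nat pmf" is
  "\<lambda>r. if r = 0 then 0 else - (1 / ln (1 - q)) * (q ^ r / real r)"
proof -
  let ?f = "\<lambda>r::nat. if r = 0 then 0 else - (1 / ln (1 - q)) * (q ^ r / real r)"
  have ln_neg: "ln (1 - q) < 0"
    using q_pos q_less_1 by (simp add: ln_less_zero_iff)
  have nonneg: "0 \<le> ?f r" for r
    proof -
    have "0 \<le> - (1 / ln (1 - q))"
      using ln_neg by simp
    then have "0 \<le> - (1 / ln (1 - q)) * (q ^ r / real r)"
      using q_pos by (intro mult_nonneg_nonneg) auto
    then show ?thesis
      by simp
  qed
  have "(\<lambda>r. - ((- (- q)) ^ r) / real r) sums ln (1 + - q)"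
    using q_pos q_less_1 by (intro ln_series') auto
  then have "(\<lambda>r. - (1 / ln (1 - q)) * - (- (q ^ r) / real r)) sums (- (1 / ln (1 - q)) * - ln (1 - q))"
    by (intro sums_mult sums_minus) simp
  moreover have "(\<lambda>r. - (1 / ln (1 - q)) * - (- (q ^ r) / real r)) = ?f"
    by (auto simp: fun_eq_iff)
  moreover have "- (1 / ln (1 - q)) * - ln (1 - q) = 1"
    using ln_neg by simp
  ultimately have sums: "?f sums 1"
    by simp
  have "(\<integral>\<^sup>+ r. ennreal (?f r) \<partial>count_space UNIV) = (\<Sum>r. ennreal (?f r))"
    by (rule nn_integral_count_space_nat)
  also have "\<dots> = ennreal 1"
    using sums nonneg by (intro suminf_ennreal_eq) auto
  finally show "(\<forall>r. 0 \<le> ?f r) \<and> (\<integral>\<^sup>+ r. ennreal (?f r) \<partial>count_space UNIV) = 1"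
    using nonneg by simp
qed

lemma pmf_logarithmic:
  "pmf logarithmic_pmf r = (if r = 0 then 0 else - (1 / ln (1 - q)) * (q ^ r / real r))"
  by (simp add: logarithmic_pmf.rep_eq)

end

(* A process is indexed by the reals, but only its values at times in [0, \<infinity>) are
   constrained.  The path conditions hold for every sample point, as usual for counting
   processes; with them the value of the process at a random time is measurable. *)
definition (in prob_space) poisson_process :: "real \<Rightarrow> (real \<Rightarrow> 'a \<Rightarrow> nat) \<Rightarrow> bool" where
  "poisson_process rate N \<longleftrightarrow>
     (\<forall>t\<ge>0. random_variable (count_space UNIV) (N t)) \<and>
     (\<forall>\<omega>\<in>space M. N 0 \<omega> = 0 \<and> mono_on {0..} (\<lambda>t. N t \<omega>) \<and>
        (\<forall>t\<ge>0. continuous (at_right t) (\<lambda>s. N s \<omega>))) \<and>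
     (\<forall>n (t :: nat \<Rightarrow> real). 0 \<le> t 0 \<longrightarrow> (\<forall>i<n. t i \<le> t (Suc i)) \<longrightarrow>
        indep_vars (\<lambda>_. count_space UNIV) (\<lambda>i \<omega>. N (t (Suc i)) \<omega> - N (t i) \<omega>) {..<n}) \<and>
     (\<forall>s\<ge>0. \<forall>t>s. distr M (count_space UNIV) (\<lambda>\<omega>. N t \<omega> - N s \<omega>)
                   = measure_pmf (poisson_pmf (rate * (t - s))))"

(* The infimum over the empty set is \<infinity>: the level is never reached on the path. *)
definition first_passage_time :: "(real \<Rightarrow> 'a \<Rightarrow> nat) \<Rightarrow> nat \<Rightarrow> 'a \<Rightarrow> ennreal" where
  "first_passage_time N k \<omega> = (INF t \<in> {t. 0 \<le> t \<and> k \<le> N t \<omega>}. ennreal t)"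

(* The event {T = \<infinity>} is null for the passage times of a Poisson process of positive
   rate; there the value is taken to be N 0, since enn2real maps \<infinity> to 0. *)
definition at_random_time :: "(real \<Rightarrow> 'a \<Rightarrow> nat) \<Rightarrow> ('a \<Rightarrow> ennreal) \<Rightarrow> 'a \<Rightarrow> nat" where
  "at_random_time N T \<omega> = N (enn2real (T \<omega>)) \<omega>"

(* The library's indep_var requires both variables to take values in the same type. *)
definition (in prob_space) indep_rv ::
    "'b measure \<Rightarrow> ('a \<Rightarrow> 'b) \<Rightarrow> 'c measure \<Rightarrow> ('a \<Rightarrow> 'c) \<Rightarrow> bool" where
  "indep_rv S X T Y \<longleftrightarrow>
     random_variable S X \<and> random_variable T Y \<and>
     indep_set {X -` A \<inter> space M | A. A \<in> sets S} {Y -` A \<inter> space M | A. A \<in> sets T}"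

definition equal_in_distribution ::
    "'a measure \<Rightarrow> ('a \<Rightarrow> 'c) \<Rightarrow> 'b measure \<Rightarrow> ('b \<Rightarrow> 'c) \<Rightarrow> 'c measure \<Rightarrow> bool" where
  "equal_in_distribution M X M' Y S \<longleftrightarrow>
     X \<in> measurable M S \<and> Y \<in> measurable M' S \<and> distr M S X = distr M' S Y"

end

(* Both sides have probability generating function ((1 - q) / (1 - q z))^k.  The passage time is
   Erlang distributed, since it is at most t exactly when the process has reached level k at time t,
   and conditioning on it turns the generating function of N\<^sub>\<alpha> at the passage time into the
   Laplace transform of the Erlang law at l\<^sub>\<alpha> (1 - z).  On the other side the sum has generating
   function exp (- \<mu> (1 - G z)), where G z = ln (1 - q z) / ln (1 - q) belongs to the logarithmic
   law and \<mu> = - k ln (1 - q). *)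
theory Submission
  imports Defs
begin

section \<open>Uniqueness of generating functions\<close>

text \<open>Once the earlier coefficients of the difference \<open>d\<close> are known to vanish,
  dividing its series by \<open>x ^ n\<close> leaves a series with value 0 on (0, 1) and constant
  term \<open>d n\<close>. Continuity at 0, used from the right, forces
  \<open>d n = 0\<close>.\<close>

lemma powser_coeff_unique:
  fixes a b :: "nat \<Rightarrow> real"
  assumes a: "\<And>z. 0 < z \<Longrightarrow> z < 1 \<Longrightarrow> (\<lambda>n. a n * z ^ n) sums f z"
    and b: "\<And>z. 0 < z \<Longrightarrow> z < 1 \<Longrightarrow> (\<lambda>n. b n * z ^ n) sums f z"
  shows "a = b"
proof -
  define d where "d n = a n - b n" for n
  have d: "(\<lambda>n. d n * z ^ n) sums 0" if "0 < z" "z < 1" for z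
    using sums_diff[OF a[OF that] b[OF that]] by (simp add: d_def algebra_simps)
  have "d n = 0" for n
  proof (induction n rule: less_induct)
    case (less n)
    define g where "g x = (\<Sum>i. d (i + n) * x ^ i)" for x
    have shift: "(\<lambda>i. d (i + n) * x ^ i) sums 0" if x: "0 < x" "x < 1" for x
    proof -
      have "(\<lambda>i. d (i + n) * x ^ (i + n)) sums (0 - (\<Sum>i<n. d i * x ^ i))"
        using d[OF x] by (rule sums_split_initial_segment)
      then have "(\<lambda>i. (d (i + n) * x ^ i) * x ^ n) sums 0"
        using less by (simp add: power_add mult_ac)
      then show ?thesis
        using x sums_mult2_iff[of "x ^ n" "\<lambda>i. d (i + n) * x ^ i" 0] by simp
    qed
    have "(\<lambda>i. d (i + n) * x ^ i) sums g x" if x: "norm x < 1" for x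
    proof -
      \<comment> \<open>\<open>x\<close> may be zero or negative, where no convergence is assumed;
        it follows from convergence at the positive point \<open>y\<close> of larger
        modulus.\<close>
      obtain y where "norm x < y" "y < 1" using dense[OF x] by blast
      moreover from this have "0 < y" using norm_ge_zero[of x] by linarith
      ultimately show ?thesis
        unfolding g_def using shift[of y]
        by (intro summable_sums powser_inside[of _ y x]) (auto dest: sums_summable)
    qed
    then have "(g \<longlongrightarrow> d (0 + n)) (at 0)"
      by (intro powser_limit_0_strong[where s = 1]) auto
    then have "(g \<longlongrightarrow> d n) (at_right 0)"
      by (simp add: filterlim_at_split)
    moreover have "\<forall>\<^sub>F x in at_right 0. g x = 0"
      using shift by (auto simp: eventually_at_right_field g_def sums_iff intro!: exI[of _ 1])
    then have "(g \<longlongrightarrow> 0) (at_right 0)"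
      by (rule tendsto_eventually)
    ultimately show ?case
      using tendsto_unique[OF trivial_limit_at_right_real] by blast
  qed
  then show ?thesis by (auto simp: d_def fun_eq_iff)
qed

lemma (in prob_space) expectation_indicator_index:
  assumes "random_variable (count_space UNIV) N"
  shows "expectation (\<lambda>\<omega>. indicator {j} (N \<omega>) :: real) = prob (N -` {j} \<inter> space M)"
proof -
  have "expectation (\<lambda>\<omega>. indicator {j} (N \<omega>) :: real)
        = expectation (indicator (N -` {j} \<inter> space M))"
    by (intro Bochner_Integration.integral_cong) (auto split: split_indicator)
  then show ?thesis by (simp add: Int_absorb2)
qed

text \<open>Splits the expectation over the value of \<open>N\<close>: pointwise,
  \<open>Y (N \<omega>) \<omega>\<close> is a sum over \<open>j\<close> with a single possibly
  nonzero term, and dominated summation moves the expectation inside. It is the common source of the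
  versions for constants and for an independent index.\<close>

lemma (in prob_space) expectation_at_uncorrelated_index:
  fixes N :: "'a \<Rightarrow> nat" and Y :: "nat \<Rightarrow> 'a \<Rightarrow> real"
  assumes N[measurable]: "random_variable (count_space UNIV) N"
    and Y[measurable]: "\<And>j. random_variable borel (Y j)"
    and bound: "\<And>j \<omega>. \<omega> \<in> space M \<Longrightarrow> norm (Y j \<omega>) \<le> 1"
    and uncorrelated: "\<And>j. expectation (\<lambda>\<omega>. indicator {j} (N \<omega>) * Y j \<omega>)
                            = prob (N -` {j} \<inter> space M) * expectation (Y j)"
  shows "(\<lambda>j. prob (N -` {j} \<inter> space M) * expectation (Y j)) sums expectation (\<lambda>\<omega>. Y (N \<omega>) \<omega>)"
proof -
  let ?f = "\<lambda>j \<omega>. indicator {j} (N \<omega>) * Y j \<omega>"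
  have finsupp: "(\<lambda>j. ?f j \<omega>) sums Y (N \<omega>) \<omega>" for \<omega>
    using sums_finite[of "{N \<omega>}" "\<lambda>j. ?f j \<omega>"] by (auto split: split_indicator)
  have bnd: "norm (?f j \<omega>) \<le> indicator {j} (N \<omega>)" if "\<omega> \<in> space M" for j \<omega>
    using bound[OF that, of j] by (auto split: split_indicator)
  have int: "integrable M (?f j)" for j
  proof (rule integrable_const_bound[where B = 1])
    show "AE \<omega> in M. norm (?f j \<omega>) \<le> 1"
      using bound by (auto intro!: AE_I2 split: split_indicator)
  qed (intro borel_measurable_times Y measurable_compose[OF N], simp)
  have int_ind: "integrable M (\<lambda>\<omega>. indicator {j} (N \<omega>) :: real)" for j
    by (rule integrable_const_bound[where B = 1])
       (auto intro!: AE_I2 measurable_compose[OF N] split: split_indicator)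
  \<comment> \<open>Countable additivity over singletons makes the point probabilities summable;
    they dominate the series of expectations of norms below.\<close>
  have "(\<lambda>j. measure (distr M (count_space UNIV) N) {j}) sums
          measure (distr M (count_space UNIV) N) (\<Union>j. {j})"
    using finite_measure.finite_measure_UNION[OF finite_measure_distr[OF N], of "\<lambda>j. {j}"]
    by (auto simp: disjoint_family_on_def)
  then have summable: "summable (\<lambda>j. prob (N -` {j} \<inter> space M))"
    by (simp add: measure_distr sums_iff)
  have "(\<lambda>j. expectation (?f j)) sums expectation (\<lambda>\<omega>. \<Sum>j. ?f j \<omega>)"
  proof (rule sums_integral)
    show "AE \<omega> in M. summable (\<lambda>j. norm (?f j \<omega>))"
    proof (rule AE_I2)
      show "summable (\<lambda>j. norm (?f j \<omega>))" for \<omega>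
        by (rule summable_finite[of "{N \<omega>}"]) auto
    qed
    show "summable (\<lambda>j. expectation (\<lambda>\<omega>. norm (?f j \<omega>)))"
    proof (rule summable_comparison_test_ev[OF always_eventually summable], intro allI)
      fix j
      have "expectation (\<lambda>\<omega>. norm (?f j \<omega>)) \<le> expectation (\<lambda>\<omega>. indicator {j} (N \<omega>) :: real)"
        using int int_ind bnd by (intro integral_mono) auto
      then show "norm (expectation (\<lambda>\<omega>. norm (?f j \<omega>))) \<le> prob (N -` {j} \<inter> space M)"
        by (simp add: expectation_indicator_index[OF N])
    qed
  qed (rule int)
  moreover have "(\<Sum>j. ?f j \<omega>) = Y (N \<omega>) \<omega>" for \<omega>
    using finsupp[of \<omega>] by (simp add: sums_iff)
  ultimately show ?thesis by (simp add: uncorrelated)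
qed

text \<open>Constants are uncorrelated with every indicator. The choice \<open>c j = z ^ j\<close>
  yields the power series of the generating function.\<close>

lemma (in prob_space) expectation_at_index:
  fixes N :: "'a \<Rightarrow> nat" and c :: "nat \<Rightarrow> real"
  assumes N[measurable]: "random_variable (count_space UNIV) N" and c: "\<And>j. \<bar>c j\<bar> \<le> 1"
  shows "(\<lambda>j. prob (N -` {j} \<inter> space M) * c j) sums expectation (\<lambda>\<omega>. c (N \<omega>))"
  using expectation_at_uncorrelated_index[OF N, of "\<lambda>j _. c j"] c
  by (simp add: prob_space expectation_indicator_index[OF N])

text \<open>The coefficients of the generating function are the point probabilities, and these
  determine a law on a countable space.\<close>

lemma distr_eq_if_pgf_eq:
  fixes N :: "'a \<Rightarrow> nat" and N' :: "'b \<Rightarrow> nat"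
  assumes "prob_space M" "prob_space M'"
    and N: "N \<in> measurable M (count_space UNIV)" and N': "N' \<in> measurable M' (count_space UNIV)"
    and eq: "\<And>z::real. 0 < z \<Longrightarrow> z < 1 \<Longrightarrow> (\<integral>\<omega>. z ^ N \<omega> \<partial>M) = (\<integral>\<omega>. z ^ N' \<omega> \<partial>M')"
  shows "distr M (count_space UNIV) N = distr M' (count_space UNIV) N'"
proof -
  interpret M: prob_space M by fact
  interpret M': prob_space M' by fact
  have "(\<lambda>n. measure M (N -` {n} \<inter> space M)) = (\<lambda>n. measure M' (N' -` {n} \<inter> space M'))"
  proof (rule powser_coeff_unique)
    fix z :: real assume "0 < z" "z < 1"
    then show "(\<lambda>n. measure M (N -` {n} \<inter> space M) * z ^ n) sums (\<integral>\<omega>. z ^ N \<omega> \<partial>M)"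
      "(\<lambda>n. measure M' (N' -` {n} \<inter> space M') * z ^ n) sums (\<integral>\<omega>. z ^ N \<omega> \<partial>M)"
      using M.expectation_at_index[OF N, of "\<lambda>n. z ^ n"] M'.expectation_at_index[OF N', of "\<lambda>n. z ^ n"]
      by (auto simp: eq power_le_one)
  qed
  then show ?thesis
    using N N' by (intro measure_eqI_countable[of _ UNIV])
      (auto simp: emeasure_distr M.emeasure_eq_measure M'.emeasure_eq_measure fun_eq_iff)
qed

lemma (in prob_space) pgf_eq_of_pmf:
  fixes N :: "'a \<Rightarrow> nat" and z :: real
  assumes N: "random_variable (count_space UNIV) N"
    and distr: "distr M (count_space UNIV) N = measure_pmf p"
    and "\<bar>z\<bar> \<le> 1" and s: "(\<lambda>n. pmf p n * z ^ n) sums s"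
  shows "expectation (\<lambda>\<omega>. z ^ N \<omega>) = s"
proof -
  have "prob (N -` {n} \<inter> space M) = pmf p n" for n
    using measure_distr[OF N, of "{n}"] by (simp add: distr pmf.rep_eq)
  then show ?thesis
    using expectation_at_index[OF N, of "\<lambda>n. z ^ n"] assms(3) s
    by (auto simp: power_abs power_le_one sums_iff)
qed

section \<open>Generating functions of the Poisson and logarithmic laws\<close>

lemma sums_poisson_pgf:
  assumes "0 < rate"
  shows "(\<lambda>n. pmf (poisson_pmf rate) n * z ^ n) sums exp (- (rate * (1 - z)))"
proof -
  have "(\<lambda>n. exp (- rate) * ((rate * z) ^ n /\<^sub>R fact n)) sums (exp (- rate) * exp (rate * z))"
    by (intro sums_mult exp_converges)
  then show ?thesis
    using assms by (simp add: power_mult_distrib field_simps flip: exp_add)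
qed

lemma sums_logarithmic_pgf:
  assumes "0 < q" "q < 1" "\<bar>z\<bar> \<le> 1"
  shows "(\<lambda>n. pmf (logarithmic_pmf q) n * z ^ n) sums (ln (1 - q * z) / ln (1 - q))"
proof -
  have "q * \<bar>z\<bar> \<le> q" using assms by (simp add: mult_left_le)
  then have "\<bar>- (q * z)\<bar> < 1"
    using assms by (simp only: abs_minus_cancel abs_mult)
  from sums_divide[OF ln_series'[OF this], of "ln (1 - q)"]
  have "(\<lambda>n. - ((q * z) ^ n) / real n / ln (1 - q)) sums (ln (1 - q * z) / ln (1 - q))"
    by simp
  \<comment> \<open>At \<open>n = 0\<close> both sides are 0, the right one because division by zero
    yields 0.\<close>
  moreover have "pmf (logarithmic_pmf q) n * z ^ n = - ((q * z) ^ n) / real n / ln (1 - q)" for n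
    using assms by (simp add: pmf_logarithmic power_mult_distrib)
  ultimately show ?thesis by simp
qed

section \<open>Independence of two random variables\<close>

text \<open>Preimage events of a composite are among those of the inner variable, and independence
  passes to subfamilies.\<close>

lemma (in prob_space) indep_rv_compose:
  assumes "indep_rv S X T Y" and f: "f \<in> measurable S S'" and g: "g \<in> measurable T T'"
  shows "indep_rv S' (\<lambda>\<omega>. f (X \<omega>)) T' (\<lambda>\<omega>. g (Y \<omega>))"
proof -
  from assms(1) have X: "random_variable S X" and Y: "random_variable T Y"
    and ind: "indep_set {X -` A \<inter> space M |A. A \<in> sets S} {Y -` A \<inter> space M |A. A \<in> sets T}"
    by (auto simp: indep_rv_def)
  have "{(\<lambda>\<omega>. h (Z \<omega>)) -` A \<inter> space M |A. A \<in> sets U'} \<subseteq> {Z -` A \<inter> space M |A. A \<in> sets U}"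
    if "Z \<in> measurable M U" "h \<in> measurable U U'" for Z :: "'a \<Rightarrow> 'z" and h :: "'z \<Rightarrow> 'y" and U U'
  proof safe
    fix A assume "A \<in> sets U'"
    then show "\<exists>B. (\<lambda>\<omega>. h (Z \<omega>)) -` A \<inter> space M = Z -` B \<inter> space M \<and> B \<in> sets U"
      using that measurable_space[OF that(1)]
      by (intro exI[of _ "h -` A \<inter> space U"]) auto
  qed
  note sub = this[OF X f] this[OF Y g]
  show ?thesis
    unfolding indep_rv_def
  proof (intro conjI)
    show "indep_set {(\<lambda>\<omega>. f (X \<omega>)) -` A \<inter> space M |A. A \<in> sets S'}
            {(\<lambda>\<omega>. g (Y \<omega>)) -` A \<inter> space M |A. A \<in> sets T'}"
      using ind unfolding indep_set_def
      by (rule indep_sets_mono_sets) (use sub in \<open>simp split: bool.split\<close>)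
  qed (use X Y f g in \<open>auto intro: measurable_compose\<close>)
qed

text \<open>Preimage families are closed under intersection, so their independence extends to the
  generated sigma-algebras. This gives access to the product rule for expectations.\<close>

lemma (in prob_space) indep_var_if_indep_rv:
  assumes "indep_rv S X T Y"
  shows "indep_var S X T Y"
  unfolding indep_var_eq
proof (intro conjI indep_set_sigma_sets)
  have *: "Int_stable {Z -` A \<inter> space M |A. A \<in> sets U}" for Z :: "'a \<Rightarrow> 'z" and U
  proof (rule Int_stableI, safe)
    fix A B assume "A \<in> sets U" "B \<in> sets U"
    then show "\<exists>C. Z -` A \<inter> space M \<inter> (Z -` B \<inter> space M) = Z -` C \<inter> space M \<and> C \<in> sets U"
      by (intro exI[of _ "A \<inter> B"]) auto
  qed
  show "Int_stable {X -` A \<inter> space M |A. A \<in> sets S}" "Int_stable {Y -` A \<inter> space M |A. A \<in> sets T}"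
    by (rule *)+
qed (use assms in \<open>auto simp: indep_rv_def\<close>)

text \<open>All \<open>Y j\<close> are functions of one variable \<open>Z\<close>, a whole path or a
  whole sequence in the applications, so independence of \<open>N\<close> and \<open>Z\<close> makes
  each \<open>Y j\<close> uncorrelated with each indicator of \<open>N\<close>.\<close>

lemma (in prob_space) expectation_at_independent_index:
  fixes N :: "'a \<Rightarrow> nat" and Y :: "nat \<Rightarrow> 'a \<Rightarrow> real"
  assumes indep: "indep_rv (count_space UNIV) N S Z"
    and g: "\<And>j. g j \<in> borel_measurable S"
    and Y: "\<And>j \<omega>. \<omega> \<in> space M \<Longrightarrow> Y j \<omega> = g j (Z \<omega>)"
    and bound: "\<And>j \<omega>. \<omega> \<in> space M \<Longrightarrow> \<bar>Y j \<omega>\<bar> \<le> 1"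
  shows "(\<lambda>j. prob (N -` {j} \<inter> space M) * expectation (Y j)) sums expectation (\<lambda>\<omega>. Y (N \<omega>) \<omega>)"
proof (rule expectation_at_uncorrelated_index)
  from indep have N[measurable]: "random_variable (count_space UNIV) N"
    and Z: "random_variable S Z" by (auto simp: indep_rv_def)
  show "random_variable (count_space UNIV) N" by fact
  show YM: "random_variable borel (Y j)" for j
    using measurable_compose[OF Z g[of j]] by (subst measurable_cong[OF Y])
  fix j
  \<comment> \<open>Both variables become real-valued here, so that they share a type and
    \<open>indep_var\<close> applies.\<close>
  have "indep_rv borel (\<lambda>\<omega>. indicator {j} (N \<omega>) :: real) borel (\<lambda>\<omega>. g j (Z \<omega>))"
    using indep by (rule indep_rv_compose) (use g in auto)
  then have "indep_var borel (\<lambda>\<omega>. indicator {j} (N \<omega>) :: real) borel (\<lambda>\<omega>. g j (Z \<omega>))"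
    by (rule indep_var_if_indep_rv)
  moreover have "integrable M (\<lambda>\<omega>. g j (Z \<omega>))"
    using measurable_compose[OF Z g[of j]] bound[of _ j]
    by (intro integrable_const_bound[where B = 1]) (auto simp: Y intro!: AE_I2)
  moreover have "integrable M (\<lambda>\<omega>. indicator {j} (N \<omega>) :: real)"
    by (rule integrable_const_bound[where B = 1])
       (auto intro!: AE_I2 measurable_compose[OF N] split: split_indicator)
  ultimately have "expectation (\<lambda>\<omega>. indicator {j} (N \<omega>) * g j (Z \<omega>))
      = expectation (\<lambda>\<omega>. indicator {j} (N \<omega>) :: real) * expectation (\<lambda>\<omega>. g j (Z \<omega>))"
    by (intro indep_var_lebesgue_integral)
  moreover have "expectation (\<lambda>\<omega>. indicator {j} (N \<omega>) :: real) = prob (N -` {j} \<inter> space M)"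
    using N by (rule expectation_indicator_index)
  ultimately show "expectation (\<lambda>\<omega>. indicator {j} (N \<omega>) * Y j \<omega>)
      = prob (N -` {j} \<inter> space M) * expectation (Y j)"
    by (simp add: Y cong: Bochner_Integration.integral_cong)
qed (use bound in auto)

section \<open>Poisson processes and their passage times\<close>

context prob_space
begin

text \<open>As the values are discrete, right continuity amounts to the path being constant on some
  interval to the right of each time.\<close>

lemma poisson_processD:
  assumes "poisson_process rate N"
  shows poisson_process_measurable: "0 \<le> t \<Longrightarrow> random_variable (count_space UNIV) (N t)"
    and poisson_process_zero: "\<omega> \<in> space M \<Longrightarrow> N 0 \<omega> = 0"
    and poisson_process_mono: "\<omega> \<in> space M \<Longrightarrow> 0 \<le> s \<Longrightarrow> s \<le> t \<Longrightarrow> N s \<omega> \<le> N t \<omega>"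
    and poisson_process_right_const:
      "\<omega> \<in> space M \<Longrightarrow> 0 \<le> t \<Longrightarrow> \<forall>\<^sub>F s in at_right t. N s \<omega> = N t \<omega>"
  using assms unfolding poisson_process_def continuous_within tendsto_discrete
  by (auto simp: mono_on_def)

lemma poisson_process_distr:
  assumes "poisson_process rate N" "0 < t"
  shows "distr M (count_space UNIV) (N t) = measure_pmf (poisson_pmf (rate * t))"
proof -
  have "distr M (count_space UNIV) (N t) = distr M (count_space UNIV) (\<lambda>\<omega>. N t \<omega> - N 0 \<omega>)"
    using poisson_process_zero[OF assms(1)] by (intro distr_cong) auto
  moreover have "distr M (count_space UNIV) (\<lambda>\<omega>. N t \<omega> - N 0 \<omega>)
      = measure_pmf (poisson_pmf (rate * (t - 0)))"
    using assms unfolding poisson_process_def by blast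
  ultimately show ?thesis by simp
qed

lemma poisson_process_pgf:
  assumes "poisson_process rate N" "0 < rate" "0 < t" "\<bar>z\<bar> \<le> 1"
  shows "expectation (\<lambda>\<omega>. z ^ N t \<omega>) = exp (- (rate * t * (1 - z)))"
proof (rule pgf_eq_of_pmf)
  show "(\<lambda>n. pmf (poisson_pmf (rate * t)) n * z ^ n) sums exp (- (rate * t * (1 - z)))"
    using assms by (intro sums_poisson_pgf) simp
qed (use assms poisson_process_measurable poisson_process_distr in auto)

text \<open>Right continuity makes the infimum attained: a path below level \<open>k\<close> at time
  \<open>a\<close> keeps its value up to some \<open>b > a\<close>, so the level is not reached
  before \<open>b\<close>.\<close>

lemma first_passage_time_le_iff:
  assumes N: "poisson_process rate N" and \<omega>: "\<omega> \<in> space M" and a: "0 \<le> a"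
  shows "first_passage_time N k \<omega> \<le> ennreal a \<longleftrightarrow> k \<le> N a \<omega>"
proof
  assume "k \<le> N a \<omega>"
  then show "first_passage_time N k \<omega> \<le> ennreal a"
    using a by (auto simp: first_passage_time_def intro: INF_lower)
next
  assume le: "first_passage_time N k \<omega> \<le> ennreal a"
  show "k \<le> N a \<omega>"
  proof (rule ccontr)
    assume less: "\<not> k \<le> N a \<omega>"
    obtain b where b: "a < b" "\<And>s. a < s \<Longrightarrow> s < b \<Longrightarrow> N s \<omega> = N a \<omega>"
      using poisson_process_right_const[OF N \<omega> a] unfolding eventually_at_right_field by blast
    have "b \<le> t" if t: "0 \<le> t" "k \<le> N t \<omega>" for t
    proof (rule ccontr)
      assume "\<not> b \<le> t"
      then have "N t \<omega> \<le> N a \<omega>"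
        using b(2)[of t] poisson_process_mono[OF N \<omega>, of t a] t by (cases "a < t") auto
      then show False using less t by simp
    qed
    then have "ennreal b \<le> first_passage_time N k \<omega>"
      unfolding first_passage_time_def by (intro INF_greatest ennreal_leI) auto
    with le have "ennreal b \<le> ennreal a" by (rule order_trans[rotated])
    then show False using a b(1) by simp
  qed
qed

text \<open>The Poisson probability of fewer than \<open>k\<close> points is the finite sum in the
  Erlang tail. The index is \<open>k - 1\<close> because \<open>erlang_CDF n\<close> belongs to
  shape \<open>n + 1\<close>.\<close>

lemma poisson_process_prob_ge:
  assumes N: "poisson_process rate N" and "0 < rate" "0 < t" "1 \<le> k"
  shows "prob {\<omega> \<in> space M. k \<le> N t \<omega>} = erlang_CDF (k - 1) rate t"
proof -
  note [measurable] = poisson_process_measurable[OF N]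
  have "prob {\<omega> \<in> space M. \<not> k \<le> N t \<omega>} = measure (distr M (count_space UNIV) (N t)) {..<k}"
    using assms by (subst measure_distr) (auto intro!: arg_cong[where f = prob])
  also have "\<dots> = (\<Sum>n<k. (rate * t) ^ n * exp (- rate * t) / fact n)"
    using assms by (simp add: poisson_process_distr[OF N] measure_measure_pmf_finite)
  also have "{..<k} = {..k - 1}" using assms by auto
  finally have "prob {\<omega> \<in> space M. \<not> k \<le> N t \<omega>} = 1 - erlang_CDF (k - 1) rate t"
    using assms by (simp add: erlang_CDF_def)
  then show ?thesis
    using assms prob_neg[of "\<lambda>\<omega>. k \<le> N t \<omega>"] by simp
qed

text \<open>The two preceding lemmas show that the distribution function at each time
  \<open>a \<ge> 0\<close> is \<open>erlang_CDF\<close>, which identifies the law once an infinite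
  passage time is excluded almost surely.\<close>

lemma first_passage_time_distributed:
  assumes N: "poisson_process rate N" and rate: "0 < rate" and k: "1 \<le> k"
    and \<tau>[measurable]: "random_variable borel (first_passage_time N k)"
  shows "distributed M lborel (\<lambda>\<omega>. enn2real (first_passage_time N k \<omega>)) (erlang_density (k - 1) rate)"
proof -
  let ?\<tau> = "first_passage_time N k"
  note [measurable] = poisson_process_measurable[OF N]
  have reach: "prob {\<omega> \<in> space M. k \<le> N t \<omega>} = erlang_CDF (k - 1) rate t" if "0 \<le> t" for t
  proof (cases "t = 0")
    case True
    then have "{\<omega> \<in> space M. k \<le> N t \<omega>} = {}"
      using k poisson_process_zero[OF N] by auto
    with True show ?thesis by (simp only: measure_empty erlang_CDF_at0)
  qed (use poisson_process_prob_ge[OF N rate _ k] that in auto)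
  \<comment> \<open>An infinite passage time means that level \<open>k\<close> is missed at every
    time \<open>n\<close>, and the probability of missing it at time \<open>n\<close> tends to
    0.\<close>
  have "prob {\<omega> \<in> space M. ?\<tau> \<omega> = \<infinity>} \<le> 1 - erlang_CDF (k - 1) rate (real n)" for n
  proof -
    have "prob {\<omega> \<in> space M. ?\<tau> \<omega> = \<infinity>} \<le> prob {\<omega> \<in> space M. \<not> k \<le> N (real n) \<omega>}"
    proof (rule finite_measure_mono)
      show "{\<omega> \<in> space M. ?\<tau> \<omega> = \<infinity>} \<subseteq> {\<omega> \<in> space M. \<not> k \<le> N (real n) \<omega>}"
      proof safe
        fix \<omega> assume "\<omega> \<in> space M" "?\<tau> \<omega> = \<infinity>" "k \<le> N (real n) \<omega>"
        then show False
          using first_passage_time_le_iff[OF N, of \<omega> "real n" k] by (simp add: top_unique)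
      qed
    qed simp
    then show ?thesis
      using prob_neg[of "\<lambda>\<omega>. k \<le> N (real n) \<omega>"] reach[of "real n"] by simp
  qed
  moreover have "(\<lambda>n. 1 - erlang_CDF (k - 1) rate (real n)) \<longlonglongrightarrow> 0"
  proof -
    have "((\<lambda>x. (rate * x) ^ n * exp (- (rate * x)) / fact n) \<longlongrightarrow> 0) at_top" for n
    proof -
      have "((\<lambda>x. (rate * x) ^ n / exp (rate * x)) \<longlongrightarrow> 0) at_top"
        by (rule filterlim_compose[OF tendsto_power_div_exp_0])
           (use rate in \<open>intro filterlim_tendsto_pos_mult_at_top[OF tendsto_const] filterlim_ident\<close>)
      from tendsto_divide[OF this tendsto_const[of "fact n"]] show ?thesis
        by (simp add: exp_minus field_simps)
    qed
    then have "((\<lambda>x. \<Sum>n\<le>k - 1. (rate * x) ^ n * exp (- (rate * x)) / fact n) \<longlongrightarrow> 0) at_top"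
      by (intro tendsto_null_sum)
    from filterlim_compose[OF this filterlim_real_sequentially] show ?thesis
      by (simp add: erlang_CDF_def)
  qed
  ultimately have "prob {\<omega> \<in> space M. ?\<tau> \<omega> = \<infinity>} \<le> 0"
    by (intro LIMSEQ_le_const) auto
  then have "AE \<omega> in M. ?\<tau> \<omega> \<noteq> \<infinity>"
    by (intro AE_I[of _ _ "{\<omega> \<in> space M. ?\<tau> \<omega> = \<infinity>}"])
       (auto simp: emeasure_eq_measure measure_le_0_iff)
  \<comment> \<open>Since \<open>enn2real\<close> maps \<infinity> to 0, the event on the left also
    contains all points with infinite passage time; the two events agree only off that null
    set.\<close>
  then have "prob {\<omega> \<in> space M. enn2real (?\<tau> \<omega>) \<le> a} = prob {\<omega> \<in> space M. k \<le> N a \<omega>}"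
    if a: "0 \<le> a" for a
  proof (intro finite_measure_eq_AE)
    show "AE \<omega> in M. \<omega> \<in> {\<omega> \<in> space M. enn2real (?\<tau> \<omega>) \<le> a} \<longleftrightarrow> \<omega> \<in> {\<omega> \<in> space M. k \<le> N a \<omega>}"
      using \<open>AE \<omega> in M. ?\<tau> \<omega> \<noteq> \<infinity>\<close>
    proof (rule AE_mp, intro AE_I2 impI)
      fix \<omega> assume "\<omega> \<in> space M" "?\<tau> \<omega> \<noteq> \<infinity>"
      then show "\<omega> \<in> {\<omega> \<in> space M. enn2real (?\<tau> \<omega>) \<le> a} \<longleftrightarrow> \<omega> \<in> {\<omega> \<in> space M. k \<le> N a \<omega>}"
        using first_passage_time_le_iff[OF N _ a, of \<omega> k] a
        by (cases "?\<tau> \<omega>") auto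
    qed
  qed (use a in measurable)
  with rate reach show ?thesis
    by (subst erlang_distributed_iff) auto
qed

text \<open>Exponential tilting: the factor \<open>exp (- (s * x))\<close> turns the Erlang density
  of rate \<open>rate\<close> into a constant multiple of the one of rate \<open>rate + s\<close>,
  whose integral is 1.\<close>

lemma erlang_distributed_laplace:
  assumes D: "distributed M lborel T (erlang_density k rate)" and rate: "0 < rate" and s: "0 \<le> s"
  shows "expectation (\<lambda>\<omega>. exp (- (s * T \<omega>))) = (rate / (rate + s)) ^ Suc k"
proof -
  interpret D: prob_space "density lborel (erlang_density k (rate + s))"
    using rate s by (intro prob_space_erlang_density) simp
  have total: "(\<integral>x. erlang_density k (rate + s) x \<partial>lborel) = 1"
    using D.prob_space rate s integral_density[of "\<lambda>_. 1::real" lborel "erlang_density k (rate + s)"]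
    by simp
  have "(rate / (rate + s)) ^ Suc k * (rate + s) ^ Suc k = rate ^ Suc k"
    using rate s by (simp flip: power_mult_distrib)
  moreover have "exp (- rate * x) * exp (- (s * x)) = exp (- (rate + s) * x)" for x
    by (simp add: algebra_simps flip: exp_add)
  ultimately have "erlang_density k rate x * exp (- (s * x))
      = (rate / (rate + s)) ^ Suc k * erlang_density k (rate + s) x" for x
    unfolding erlang_density_def by (simp del: power_Suc flip: mult.assoc)
  then have "(\<integral>x. erlang_density k rate x * exp (- (s * x)) \<partial>lborel) = (rate / (rate + s)) ^ Suc k"
    by (simp add: total)
  then show ?thesis
    using rate by (subst distributed_integral[OF D, symmetric]) auto
qed

section \<open>A Poisson process at an independent random time\<close>

lemma indep_rv_commute:
  assumes "indep_rv S X T Y"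
  shows "indep_rv T Y S X"
proof -
  have "indep_set B A" if "indep_set A B" for A B
    using that unfolding indep_sets2_eq by (metis Int_commute mult.commute)
  then show ?thesis using assms by (auto simp: indep_rv_def)
qed

text \<open>
  Evaluation at time \<open>T\<close> is not a measurable function on the product space of paths, so \<open>T\<close> is
  approximated from the right by \<open>(\<lfloor>n * T\<rfloor> + 1) / n\<close>, which takes countably many values;
  right continuity makes the integer-valued path eventually constant along this sequence.
\<close>
lemma poisson_process_at_independent_time:
  assumes N: "poisson_process rate N" and rate: "0 < rate"
    and indep: "indep_rv (PiM {0..} (\<lambda>_. count_space UNIV)) (\<lambda>\<omega>. \<lambda>t\<in>{0..}. N t \<omega>) borel T"
    and T_nonneg: "\<And>\<omega>. \<omega> \<in> space M \<Longrightarrow> (0::real) \<le> T \<omega>"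
  shows poisson_process_at_independent_time_measurable:
      "random_variable (count_space UNIV) (\<lambda>\<omega>. N (T \<omega>) \<omega>)"
    and poisson_process_at_independent_time_pgf:
      "0 < z \<Longrightarrow> z < 1 \<Longrightarrow>
        expectation (\<lambda>\<omega>. z ^ N (T \<omega>) \<omega>) = expectation (\<lambda>\<omega>. exp (- (rate * (1 - z) * T \<omega>)))"
proof -
  from indep have T[measurable]: "random_variable borel T" by (simp add: indep_rv_def)
  note [measurable] = poisson_process_measurable[OF N]
  \<comment> \<open>\<open>J n\<close> numbers the cell of mesh \<open>1 / Suc n\<close> containing
    \<open>T\<close>, and \<open>t n j\<close> is the right end of cell \<open>j\<close>. Hence the
    approximation is strictly later than \<open>T\<close> and never 0.\<close>
  define J where "J n \<omega> = nat \<lfloor>real (Suc n) * T \<omega>\<rfloor>" for n \<omega>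
  define t where "t n j = real (Suc j) / real (Suc n)" for n j
  have t_pos: "0 < t n j" for n j by (simp add: t_def)
  have J[measurable]: "random_variable (count_space UNIV) (J n)" for n
    unfolding J_def by measurable
  have approx: "T \<omega> < t n (J n \<omega>)" "t n (J n \<omega>) \<le> T \<omega> + 1 / real (Suc n)" if "\<omega> \<in> space M" for n \<omega>
  proof -
    have "0 \<le> real (Suc n) * T \<omega>" using T_nonneg[OF that] by simp
    then have J: "real (Suc n) * T \<omega> < real (Suc (J n \<omega>))" "real (Suc (J n \<omega>)) \<le> real (Suc n) * T \<omega> + 1"
      unfolding J_def of_nat_Suc by linarith+
    show "T \<omega> < t n (J n \<omega>)"
      using J(1) by (simp only: t_def pos_less_divide_eq of_nat_0_less_iff zero_less_Suc mult.commute)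
    have "t n (J n \<omega>) \<le> (real (Suc n) * T \<omega> + 1) / real (Suc n)"
      unfolding t_def using J(2) by (rule divide_right_mono) simp
    then show "t n (J n \<omega>) \<le> T \<omega> + 1 / real (Suc n)"
      by (simp add: add_divide_distrib del: of_nat_Suc)
  qed
  have t_lim: "(\<lambda>n. t n (J n \<omega>)) \<longlonglongrightarrow> T \<omega>" if "\<omega> \<in> space M" for \<omega>
  proof (rule tendsto_sandwich[of "\<lambda>_. T \<omega>" _ _ "\<lambda>n. T \<omega> + 1 / real (Suc n)"])
    show "(\<lambda>n. T \<omega> + 1 / real (Suc n)) \<longlonglongrightarrow> T \<omega>"
      using tendsto_add[OF tendsto_const lim_1_over_n[THEN LIMSEQ_Suc]] by force
  qed (use approx[OF that] in \<open>auto intro: less_imp_le always_eventually\<close>)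
  have N_lim: "\<forall>\<^sub>F n in sequentially. N (t n (J n \<omega>)) \<omega> = N (T \<omega>) \<omega>" if "\<omega> \<in> space M" for \<omega>
  proof -
    \<comment> \<open>The strict inequality puts the limit in \<open>at_right\<close>, where the
      path is eventually constant.\<close>
    have "filterlim (\<lambda>n. t n (J n \<omega>)) (at_right (T \<omega>)) sequentially"
      using t_lim[OF that] approx(1)[OF that]
      by (auto simp: filterlim_at less_imp_neq[symmetric] intro!: always_eventually)
    then show ?thesis
      using poisson_process_right_const[OF N that T_nonneg[OF that]]
      by (rule filterlim_iff[THEN iffD1, rule_format])
  qed
  have meas: "random_variable (count_space UNIV) (\<lambda>\<omega>. N (t n (J n \<omega>)) \<omega>)" for n
    by (rule measurable_compose_countable[where f = "\<lambda>j. N (t n j)", OF _ J])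
       (intro poisson_process_measurable[OF N] less_imp_le t_pos)
  show meas_T: "random_variable (count_space UNIV) (\<lambda>\<omega>. N (T \<omega>) \<omega>)"
  proof (rule measurable_count_space_eq2_countable[THEN iffD2], safe)
    fix m :: nat
    \<comment> \<open>The approximating values are eventually equal to the limit, so the event is a
      countable union of countable intersections of measurable events.\<close>
    have "(\<lambda>\<omega>. N (T \<omega>) \<omega>) -` {m} \<inter> space M
        = {\<omega> \<in> space M. \<forall>\<^sub>F n in sequentially. N (t n (J n \<omega>)) \<omega> = m}"
    proof -
      have "(\<forall>\<^sub>F n in sequentially. N (t n (J n \<omega>)) \<omega> = m) \<longleftrightarrow> N (T \<omega>) \<omega> = m"
        if "\<omega> \<in> space M" for \<omega>
      proof -
        have "(\<forall>\<^sub>F n in sequentially. N (t n (J n \<omega>)) \<omega> = m)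
            \<longleftrightarrow> (\<forall>\<^sub>F n in sequentially. N (T \<omega>) \<omega> = m)"
          by (rule eventually_cong[OF N_lim[OF that]]) simp
        then show ?thesis by simp
      qed
      then show ?thesis by auto
    qed
    also have "\<dots> \<in> events"
      using meas unfolding eventually_sequentially by measurable
    finally show "(\<lambda>\<omega>. N (T \<omega>) \<omega>) -` {m} \<inter> space M \<in> events" .
  qed auto
  fix z :: real assume z: "0 < z" "z < 1"
  let ?s = "rate * (1 - z)"
  have s: "0 < ?s" using rate z by simp
  have indep_J: "indep_rv (count_space UNIV) (J n)
      (PiM {0..} (\<lambda>_. count_space UNIV)) (\<lambda>\<omega>. \<lambda>t\<in>{0..}. N t \<omega>)" for n
  proof -
    have "indep_rv (PiM {0..} (\<lambda>_. count_space UNIV)) (\<lambda>\<omega>. \<lambda>t\<in>{0..}. N t \<omega>)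
        (count_space UNIV) (\<lambda>\<omega>. nat \<lfloor>real (Suc n) * T \<omega>\<rfloor>)"
      using indep by (rule indep_rv_compose) auto
    then show ?thesis
      unfolding J_def by (rule indep_rv_commute)
  qed
  \<comment> \<open>On \<open>J n = j\<close> the path is read at the fixed time
    \<open>t n j\<close>, where the Poisson generating function applies. The resulting series is
    also the expansion of the right-hand side over the values of \<open>J n\<close>.\<close>
  have discrete: "expectation (\<lambda>\<omega>. z ^ N (t n (J n \<omega>)) \<omega>) = expectation (\<lambda>\<omega>. exp (- (?s * t n (J n \<omega>))))"
    for n
  proof -
    have "(\<lambda>j. prob (J n -` {j} \<inter> space M) * expectation (\<lambda>\<omega>. z ^ N (t n j) \<omega>)) sums
        expectation (\<lambda>\<omega>. z ^ N (t n (J n \<omega>)) \<omega>)"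
    proof (rule expectation_at_independent_index[OF indep_J])
      fix j
      have "(\<lambda>f. f (t n j)) \<in> measurable (PiM {0..} (\<lambda>_. count_space UNIV :: nat measure)) (count_space UNIV)"
        using t_pos[of n j] by (intro measurable_component_singleton) auto
      then show "(\<lambda>f. z ^ f (t n j)) \<in> borel_measurable (PiM {0..} (\<lambda>_. count_space UNIV))"
        by (rule measurable_compose[where g = "power z"]) simp
    qed (use z t_pos[THEN less_imp_le] in \<open>auto simp: power_le_one\<close>)
    moreover have "expectation (\<lambda>\<omega>. z ^ N (t n j) \<omega>) = exp (- (?s * t n j))" for j
      using poisson_process_pgf[OF N rate t_pos[of n j], of z] z by (simp add: mult_ac)
    moreover have "(\<lambda>j. prob (J n -` {j} \<inter> space M) * exp (- (?s * t n j))) sums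
        expectation (\<lambda>\<omega>. exp (- (?s * t n (J n \<omega>))))"
      using s t_pos[of n] by (intro expectation_at_index J) (simp add: less_imp_le)
    ultimately show ?thesis by (simp add: sums_iff)
  qed
  \<comment> \<open>Both sides of \<open>discrete\<close> converge by dominated convergence with
    majorant 1.\<close>
  have "(\<lambda>n. expectation (\<lambda>\<omega>. z ^ N (t n (J n \<omega>)) \<omega>)) \<longlonglongrightarrow> expectation (\<lambda>\<omega>. z ^ N (T \<omega>) \<omega>)"
  proof (rule integral_dominated_convergence[where w = "\<lambda>_. 1"])
    show "AE \<omega> in M. (\<lambda>n. z ^ N (t n (J n \<omega>)) \<omega>) \<longlonglongrightarrow> z ^ N (T \<omega>) \<omega>"
    proof (rule AE_I2, rule tendsto_eventually)
      fix \<omega> assume "\<omega> \<in> space M"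
      from N_lim[OF this] show "\<forall>\<^sub>F n in sequentially. z ^ N (t n (J n \<omega>)) \<omega> = z ^ N (T \<omega>) \<omega>"
        by eventually_elim simp
    qed
  qed (use z measurable_compose[OF meas, where g = "power z"]
        measurable_compose[OF meas_T, where g = "power z"] in
        \<open>auto simp: power_le_one intro!: AE_I2\<close>)
  moreover have "(\<lambda>n. expectation (\<lambda>\<omega>. exp (- (?s * t n (J n \<omega>)))))
      \<longlonglongrightarrow> expectation (\<lambda>\<omega>. exp (- (?s * T \<omega>)))"
  proof (rule integral_dominated_convergence[where w = "\<lambda>_. 1"])
    show "AE \<omega> in M. (\<lambda>n. exp (- (?s * t n (J n \<omega>)))) \<longlonglongrightarrow> exp (- (?s * T \<omega>))"
      by (intro AE_I2 tendsto_intros t_lim)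
    show "AE \<omega> in M. norm (exp (- (?s * t n (J n \<omega>)))) \<le> 1" for n
      using s t_pos[of n] by (intro AE_I2) (simp add: less_imp_le)
    show "random_variable borel (\<lambda>\<omega>. exp (- (?s * t n (J n \<omega>))))" for n
      by measurable
  qed auto
  ultimately show "expectation (\<lambda>\<omega>. z ^ N (T \<omega>) \<omega>) = expectation (\<lambda>\<omega>. exp (- (?s * T \<omega>)))"
    unfolding discrete by (rule LIMSEQ_unique)
qed

section \<open>Generating function of a random sum\<close>

text \<open>Given \<open>N = m\<close>, the power of the sum is a product of \<open>m\<close>
  independent factors with mean \<open>G\<close>; resumming over \<open>m\<close> gives the
  generating function of \<open>N\<close> at \<open>G\<close>.\<close>

lemma compound_pgf:
  fixes N :: "'a \<Rightarrow> nat" and X :: "nat \<Rightarrow> 'a \<Rightarrow> nat" and z G :: real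
  assumes X: "indep_vars (\<lambda>_. count_space UNIV) X {1..}"
    and indep: "indep_rv (count_space UNIV) N
      (PiM {1..} (\<lambda>_. count_space UNIV)) (\<lambda>\<omega>. \<lambda>i\<in>{1..}. X i \<omega>)"
    and z: "0 < z" "z < 1"
    and G: "\<And>i. 1 \<le> i \<Longrightarrow> expectation (\<lambda>\<omega>. z ^ X i \<omega>) = G"
  shows "expectation (\<lambda>\<omega>. z ^ (\<Sum>i=1..N \<omega>. X i \<omega>)) = expectation (\<lambda>\<omega>. G ^ N \<omega>)"
proof -
  from indep have N: "random_variable (count_space UNIV) N" by (simp add: indep_rv_def)
  have "(\<lambda>m. prob (N -` {m} \<inter> space M) * expectation (\<lambda>\<omega>. z ^ (\<Sum>i=1..m. X i \<omega>))) sums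
      expectation (\<lambda>\<omega>. z ^ (\<Sum>i=1..N \<omega>. X i \<omega>))"
  proof (rule expectation_at_independent_index[OF indep, where g = "\<lambda>m f. z ^ (\<Sum>i=1..m. f i)"])
    fix m
    have "(\<lambda>f. z ^ f i) \<in> borel_measurable (PiM {1..} (\<lambda>_. count_space UNIV :: nat measure))"
      if "i \<in> {1..m}" for i
      using that by (intro measurable_compose[OF measurable_component_singleton, where g = "power z"]) auto
    then have "(\<lambda>f. \<Prod>i=1..m. z ^ f i) \<in> borel_measurable (PiM {1..} (\<lambda>_. count_space UNIV))"
      by (rule borel_measurable_prod)
    then show "(\<lambda>f. z ^ (\<Sum>i=1..m. f i)) \<in> borel_measurable (PiM {1..} (\<lambda>_. count_space UNIV))"
      by (simp add: power_sum)
  qed (use z in \<open>auto simp: power_le_one\<close>)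
  moreover have "expectation (\<lambda>\<omega>. z ^ (\<Sum>i=1..m. X i \<omega>)) = G ^ m" for m
  proof -
    have rv: "random_variable (count_space UNIV) (X i)" if "1 \<le> i" for i
      using X that by (auto simp: indep_vars_def)
    have "indep_vars (\<lambda>_. borel) (\<lambda>i \<omega>. z ^ X i \<omega>) {1..m}"
      by (rule indep_vars_subset[OF indep_vars_compose2[OF X]]) auto
    then have "expectation (\<lambda>\<omega>. \<Prod>i=1..m. z ^ X i \<omega>) = (\<Prod>i=1..m. expectation (\<lambda>\<omega>. z ^ X i \<omega>))"
    proof (rule indep_vars_lebesgue_integral[rotated])
      fix i assume i: "i \<in> {1..m}"
      have "random_variable borel (\<lambda>\<omega>. z ^ X i \<omega>)"
        using i by (intro measurable_compose[OF rv, where g = "power z"]) auto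
      then show "integrable M (\<lambda>\<omega>. z ^ X i \<omega>)"
        using z by (intro integrable_const_bound[where B = 1]) (auto simp: power_le_one intro!: AE_I2)
    qed simp
    then show ?thesis by (simp add: power_sum G)
  qed
  \<comment> \<open>Bounds the sequence \<open>G ^ m\<close>, as \<open>expectation_at_index\<close>
    requires.\<close>
  moreover have "\<bar>G\<bar> \<le> 1"
  proof -
    have X1: "random_variable (count_space UNIV) (X 1)" using X by (auto simp: indep_vars_def)
    have "norm G \<le> expectation (\<lambda>\<omega>. norm (z ^ X 1 \<omega>))"
      unfolding G[of 1, OF order_refl, symmetric] by (rule integral_norm_bound)
    also have "\<dots> \<le> 1"
      using z X1 by (intro integral_le_const integrable_const_bound[where B = 1])
        (auto simp: power_le_one intro!: AE_I2 measurable_compose[OF X1])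
    finally show ?thesis by simp
  qed
  ultimately show ?thesis
    using expectation_at_index[OF N, of "\<lambda>m. G ^ m"]
    by (simp add: sums_iff power_abs power_le_one)
qed

end

section \<open>Comparison of the two generating functions\<close>

theorem theorem3p2:
  fixes M :: "'a measure" and M' :: "'b measure"
    and l\<^sub>\<alpha> l\<^sub>\<beta> \<mu> q :: real and k :: nat
    and N\<^sub>\<alpha> N\<^sub>\<beta> :: "real \<Rightarrow> 'a \<Rightarrow> nat" and \<tau> :: "'a \<Rightarrow> ennreal"
    and N :: "'b \<Rightarrow> nat" and X :: "nat \<Rightarrow> 'b \<Rightarrow> nat"
  assumes "l\<^sub>\<alpha> > 0" and "l\<^sub>\<beta> > 0" and "k \<ge> 1"
    and "prob_space M"
    and "prob_space.poisson_process M l\<^sub>\<beta> N\<^sub>\<beta>"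
    and "\<tau> = first_passage_time N\<^sub>\<beta> k"
    and "prob_space.poisson_process M l\<^sub>\<alpha> N\<^sub>\<alpha>"
    and "prob_space.indep_rv M
           (PiM {0..} (\<lambda>_. count_space UNIV)) (\<lambda>\<omega>. \<lambda>t\<in>{0..}. N\<^sub>\<alpha> t \<omega>) borel \<tau>"
    and "\<mu> = ln (((l\<^sub>\<alpha> + l\<^sub>\<beta>) / l\<^sub>\<beta>) ^ k)"
    and "q = l\<^sub>\<alpha> / (l\<^sub>\<alpha> + l\<^sub>\<beta>)"
    and "prob_space M'"
    and "N \<in> measurable M' (count_space UNIV)"
    and "distr M' (count_space UNIV) N = measure_pmf (poisson_pmf \<mu>)"
    and "prob_space.indep_vars M' (\<lambda>_. count_space UNIV) X {1..}"
    and "\<And>i. i \<ge> 1 \<Longrightarrow> distr M' (count_space UNIV) (X i) = measure_pmf (logarithmic_pmf q)"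
    and "prob_space.indep_rv M' (count_space UNIV) N
           (PiM {1..} (\<lambda>_. count_space UNIV)) (\<lambda>\<omega>. \<lambda>i\<in>{1..}. X i \<omega>)"
  shows "equal_in_distribution M (at_random_time N\<^sub>\<alpha> \<tau>)
           M' (\<lambda>\<omega>. \<Sum>i=1..N \<omega>. X i \<omega>) (count_space UNIV)"
proof -
  interpret M: prob_space M by fact
  interpret M': prob_space M' by fact
  let ?T = "\<lambda>\<omega>. enn2real (\<tau> \<omega>)"
  have \<tau>: "\<tau> \<in> borel_measurable M"
    using assms(8) by (simp add: M.indep_rv_def)
  have indep: "M.indep_rv (PiM {0..} (\<lambda>_. count_space UNIV)) (\<lambda>\<omega>. \<lambda>t\<in>{0..}. N\<^sub>\<alpha> t \<omega>) borel ?T"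
    using assms(8) by (rule M.indep_rv_compose) auto
  note at_T = M.poisson_process_at_independent_time[OF assms(7,1) indep enn2real_nonneg]
  have lhs: "at_random_time N\<^sub>\<alpha> \<tau> \<in> measurable M (count_space UNIV)"
    using at_T(1) by (simp add: at_random_time_def[abs_def])
  have X: "X i \<in> measurable M' (count_space UNIV)" if "1 \<le> i" for i
    using assms(14) that by (auto simp: M'.indep_vars_def)
  from assms(12) have rhs: "(\<lambda>\<omega>. \<Sum>i=1..N \<omega>. X i \<omega>) \<in> measurable M' (count_space UNIV)"
  proof (rule measurable_compose_countable[rotated])
    show "(\<lambda>\<omega>. \<Sum>i=1..m. X i \<omega>) \<in> measurable M' (count_space UNIV)" for m
      by (intro measurable_sum_nat X) simp
  qed
  have "distr M (count_space UNIV) (at_random_time N\<^sub>\<alpha> \<tau>)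
      = distr M' (count_space UNIV) (\<lambda>\<omega>. \<Sum>i=1..N \<omega>. X i \<omega>)"
  proof (rule distr_eq_if_pgf_eq[OF assms(4,11) lhs rhs])
    fix z :: real assume z: "0 < z" "z < 1"
    let ?s = "l\<^sub>\<alpha> * (1 - z)"
    let ?G = "ln (1 - q * z) / ln (1 - q)"
    \<comment> \<open>The common denominator lets the ratio of \<open>1 - q\<close> to
      \<open>1 - q * z\<close> reduce to \<open>l\<^sub>\<beta> / (l\<^sub>\<beta> + ?s)\<close>,
      the base in the Erlang transform.\<close>
    have q: "0 < q" "q < 1" "1 - q = l\<^sub>\<beta> / (l\<^sub>\<alpha> + l\<^sub>\<beta>)" "1 - q * z = (l\<^sub>\<beta> + ?s) / (l\<^sub>\<alpha> + l\<^sub>\<beta>)"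
      using assms(1,2) unfolding assms(10) by (auto simp: field_simps)
    have s: "0 < ?s" using assms(1) z by simp
    have \<mu>: "\<mu> = - real k * ln (1 - q)" "0 < \<mu>"
    proof -
      show "\<mu> = - real k * ln (1 - q)"
        using assms(1,2) unfolding assms(9) q(3) by (simp add: ln_realpow ln_div) argo
      then show "0 < \<mu>"
        using q(1,2) assms(3) by (simp add: mult_less_0_iff ln_less_zero_iff)
    qed
    have ln_neg: "ln (1 - q) < 0" using q(1,2) by (simp add: ln_less_zero_iff)
    have qz: "0 < 1 - q * z" using q(4) s assms(1,2) by simp
    \<comment> \<open>The Poisson generating function is evaluated at \<open>?G\<close> below, which
      must lie in its range of validity.\<close>
    have G_bound: "\<bar>?G\<bar> \<le> 1"
    proof -
      have "q * z \<le> q" using q(1) z by (simp add: mult_left_le)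
      then have "ln (1 - q) \<le> ln (1 - q * z)" using q(2) by simp
      moreover have "ln (1 - q * z) < 0" using qz q(1) z by (simp add: ln_less_zero_iff)
      ultimately show ?thesis using ln_neg by (simp add: divide_le_eq abs_of_nonneg divide_nonpos_nonpos)
    qed
    have "(\<integral>\<omega>. z ^ at_random_time N\<^sub>\<alpha> \<tau> \<omega> \<partial>M) = (\<integral>\<omega>. exp (- (?s * ?T \<omega>)) \<partial>M)"
      unfolding at_random_time_def by (rule at_T(2)[OF z])
    \<comment> \<open>The density index \<open>k - 1\<close> gives the exponent
      \<open>Suc (k - 1)\<close>, which is \<open>k\<close> because
      \<open>k \<ge> 1\<close>.\<close>
    also have "\<dots> = (l\<^sub>\<beta> / (l\<^sub>\<beta> + ?s)) ^ Suc (k - 1)"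
      unfolding assms(6)
      by (rule M.erlang_distributed_laplace[OF M.first_passage_time_distributed[
            OF assms(5,2,3) \<tau>[unfolded assms(6)]] assms(2) less_imp_le[OF s]])
    also have "\<dots> = ((1 - q) / (1 - q * z)) ^ k"
      unfolding q(3,4) using assms(1-3) by (simp only: Suc_diff_1 divide_divide_eq_right) simp
    also have "\<dots> = exp (real k * (ln (1 - q) - ln (1 - q * z)))"
      using q(2) qz by (simp add: exp_of_nat_mult exp_diff)
    \<comment> \<open>Factoring out \<open>ln (1 - q)\<close> exposes the Poisson exponent at
      \<open>?G\<close>: \<open>\<mu>\<close> is \<open>- real k * ln (1 - q)\<close> and
      \<open>?G\<close> is the ratio of the two logarithms.\<close>
    also have "real k * (ln (1 - q) - ln (1 - q * z)) = - (\<mu> * (1 - ?G))"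
      using ln_neg unfolding \<mu>(1) by (simp add: field_simps)
    also have "exp \<dots> = (\<integral>\<omega>. ?G ^ N \<omega> \<partial>M')"
      using M'.pgf_eq_of_pmf[OF assms(12,13) G_bound sums_poisson_pgf[OF \<mu>(2)]] by simp
    also have "\<dots> = (\<integral>\<omega>. z ^ (\<Sum>i=1..N \<omega>. X i \<omega>) \<partial>M')"
      using z q(1,2) by (intro M'.compound_pgf[OF assms(14,16), symmetric]
          M'.pgf_eq_of_pmf[OF X assms(15) _ sums_logarithmic_pgf]) auto
    finally show "(\<integral>\<omega>. z ^ at_random_time N\<^sub>\<alpha> \<tau> \<omega> \<partial>M) = (\<integral>\<omega>. z ^ (\<Sum>i=1..N \<omega>. X i \<omega>) \<partial>M')" .
  qed
  with lhs rhs show ?thesis by (simp add: equal_in_distribution_def)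
qed

end
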